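(* Let $K$ be a positive integer, let $c_1\le c_2\le\dots\le c_K$ be positive integers, let $p_1,\dots,p_K\in(0,1]$ and $P^{\mathrm{th}}_{\mathrm{out}}\in(0,1]$ with $\prod_{k=1}^Kp_k\le P^{\mathrm{th}}_{\mathrm{out}}$, and let $\epsilon>0$. Then the complexity of Algorithm 2 (defined in the context) on this input is $O(K^2\tilde c_{\max})=O(K^2\lceil K/\epsilon\rceil)=O(K^3/\epsilon)$, where $\tilde c_{\max}=\max_k\tilde c_k=\lceil K/\epsilon\rceil$ is the largest of the integers $\tilde c_k$ computed by Algorithm 2. As a result, Algorithm 2 has polynomial complexity in $K$ and $1/\epsilon$. In particular, for any fixed $\epsilon>0$, Algorithm 2 has cubic complexity $O(K^3)$.
   Context: Complexity is the number of elementary operations (arithmetic operations on real numbers including logarithms and ceilings, comparisons, assignments, table accesses), each counted at unit cost. Algorithm 1 (dynamic programming). Input: a positive integer $K$, positive integers $c_1\le\dots\le c_K$, $p_1,\dots,p_K\in(0,1]$, and $P^{\mathrm{th}}_{\mathrm{out}}\in(0,1]$ with $\prod_{k}p_k\le P^{\mathrm{th}}_{\mathrm{out}}$. (i) Set $a_k:=-\log(p_k)$ for all $k$ and $b:=-\log(P^{\mathrm{th}}_{\mathrm{out}})$. (ii) Set $A:=0$, $C:=0$, $k:=1$; while $A<b$ do: $A:=A+a_k$, $C:=C+c_k$, $k:=k+1$. (iii) Set $R(0,0):=0$ and $R(0,j):=-\infty$ for $j=1,\dots,C$. For $i=1,\dots,K$ and $j=0,\dots,C$ set $R(i,j):=\max\{R(i-1,j),\,a_i+R(i-1,j-c_i)\}$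 if $j\ge c_i$, and $R(i,j):=R(i-1,j)$ otherwise. (iv) Set $j^*:=\min\{j\in\{0,\dots,C\}:R(K,j)\ge b\}$, $q:=R(K,j^* )$, $j:=j^*$. For $i=K,K-1,\dots,1$: if $q=R(i-1,j)$, set $z_i:=0$ and $q:=R(i-1,j)$; otherwise set $z_i:=1$, $q:=R(i-1,j-c_i)$, $j:=j-c_i$. Output: $[z_1,\dots,z_K]$. Algorithm 2 (approximation algorithm). Input: the same data as Algorithm 1, together with a real $\epsilon>0$. Set $\vartheta:=\epsilon c_{\max}/K$ with $c_{\max}=\max_kc_k=c_K$, and $\tilde c_k:=\lceil c_k/\vartheta\rceil$ for all $k$ (positive integers with $\tilde c_1\le\dots\le\tilde c_K$). Run Algorithm 1 with input $[K,(\tilde c_1,\dots,\tilde c_K),(p_1,\dots,p_K),P^{\mathrm{th}}_{\mathrm{out}}]$ and return its output.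
   Formalization: The bound O(K^3/ε) and its equality with O(K^2⌈K/ε⌉) are stated for ε ≤ M·K, for each M > 0 (constant depending on M), since uniformly over all ε > 0 they fail: for K = 1 and ε → ∞, ⌈K/ε⌉ ≥ 1 while K^3/ε → 0. *)

theory Defs
  imports
    Complex_Main
    "HOL-Library.Extended_Real"
    "HOL-Library.Landau_Symbols"
    "HOL-Library.Monad_Syntax"
begin

section \<open>Programs with unit-cost accounting\<close>

text \<open>
  A terminating run is \<open>Some (result, number of elementary operations)\<close>; a diverging one is
  \<open>None\<close>. Costs enter only through \<open>op\<close>: every argument of \<open>op\<close> below consists of exactly one
  arithmetic operation, comparison, table read, table write or assignment to a variable.
  (The inclusions of \<open>nat\<close> into \<open>real\<close> and of \<open>real\<close> into \<open>ereal\<close> are not operations, and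
  neither is renaming an already computed value by \<open>\<leftarrow>\<close>.)
\<close>

type_synonym 'a prog = "('a \<times> nat) option"

definition return :: "'a \<Rightarrow> 'a prog" where
  "return x = Some (x, 0)"

definition op :: "'a \<Rightarrow> 'a prog" where
  "op x = Some (x, 1)"

definition seq :: "'a prog \<Rightarrow> ('a \<Rightarrow> 'b prog) \<Rightarrow> 'b prog" where
  "seq m f = Option.bind m (\<lambda>(x, s). Option.bind (f x) (\<lambda>(y, t). Some (y, s + t)))"

no_adhoc_overloading Monad_Syntax.bind \<rightleftharpoons> Option.bind
adhoc_overloading Monad_Syntax.bind \<rightleftharpoons> seq

definition steps :: "'a prog \<Rightarrow> nat" where
  "steps m = snd (the m)"

lemma seq_mono [partial_function_mono]:
  assumes "mono_option B" and "\<And>y. mono_option (\<lambda>f. C y f)"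
  shows "mono_option (\<lambda>f. seq (B f) (\<lambda>y. C y f))"
proof -
  have "mono_option (\<lambda>f. case z of (x, s) \<Rightarrow>
      Option.bind (C x f) (\<lambda>(y, t). Some (y, s + t)))" for z
    by (cases z) (auto intro!: bind_mono assms option.const_mono split: prod.splits)
  then show ?thesis
    unfolding seq_def by (intro bind_mono assms(1))
qed

partial_function (option) while_loop ::
  "('s \<Rightarrow> bool prog) \<Rightarrow> ('s \<Rightarrow> 's prog) \<Rightarrow> 's \<Rightarrow> 's prog" where
  "while_loop test body s =
    do { b \<leftarrow> test s;
         if b then do { s' \<leftarrow> body s; while_loop test body s' }
         else return s }"

text \<open>
  A counting loop over the listed values of its loop variable. The three operations charged per
  round are the change of the loop variable, its assignment, and the comparison with the final
  value; the last comparison, which ends the loop, is charged in the base case.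
\<close>

fun for_loop :: "nat list \<Rightarrow> (nat \<Rightarrow> 's \<Rightarrow> 's prog) \<Rightarrow> 's \<Rightarrow> 's prog" where
  "for_loop [] body s = do { op (); return s }"
| "for_loop (i # is) body s =
    do { op (); op (); op (); s' \<leftarrow> body i s; for_loop is body s' }"


section \<open>Algorithm 1: dynamic programming\<close>

text \<open>
  Tables are total functions; the sequences \<open>c\<close>, \<open>p\<close>, \<open>a\<close>, \<open>z\<close> are used at the indices
  \<open>1, \<dots>, K\<close> only. Tables that are about to be filled start as \<open>undefined\<close>.
\<close>

definition log_weights :: "nat \<Rightarrow> (nat \<Rightarrow> real) \<Rightarrow> (nat \<Rightarrow> real) prog" where
  "log_weights K p =
    for_loop [1..<Suc K]
      (\<lambda>k a. do {
         x \<leftarrow> op (p k);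
         l \<leftarrow> op (ln x);
         v \<leftarrow> op (- l);
         op (a(k := v)) })
      undefined"

definition prefix_cost :: "(nat \<Rightarrow> nat) \<Rightarrow> (nat \<Rightarrow> real) \<Rightarrow> real \<Rightarrow> nat prog" where
  "prefix_cost c a b =
    do { A \<leftarrow> op 0;
         C \<leftarrow> op 0;
         k \<leftarrow> op 1;
         (A, C, k) \<leftarrow> while_loop
           (\<lambda>(A, C, k). op (A < b))
           (\<lambda>(A, C, k). do {
              x \<leftarrow> op (a k);
              A' \<leftarrow> op (A + x);
              A \<leftarrow> op A';
              y \<leftarrow> op (c k);
              C' \<leftarrow> op (C + y);
              C \<leftarrow> op C';
              k' \<leftarrow> op (k + 1);
              k \<leftarrow> op k';
              return (A, C, k) })
           (A, C, k);
         return C }"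

definition fill_table ::
  "nat \<Rightarrow> (nat \<Rightarrow> nat) \<Rightarrow> (nat \<Rightarrow> real) \<Rightarrow> nat \<Rightarrow> (nat \<times> nat \<Rightarrow> ereal) prog" where
  "fill_table K c a C =
    do { R \<leftarrow> op (undefined((0, 0) := 0));
         R \<leftarrow> for_loop [1..<Suc C] (\<lambda>j R. op (R((0, j) := -\<infinity>))) R;
         for_loop [1..<Suc K]
           (\<lambda>i. for_loop [0..<Suc C]
             (\<lambda>j R. do {
                i' \<leftarrow> op (i - 1);
                u \<leftarrow> op (R (i', j));
                ci \<leftarrow> op (c i);
                fits \<leftarrow> op (j \<ge> ci);
                if fits then do {
                  x \<leftarrow> op (a i);
                  j' \<leftarrow> op (j - ci);
                  v \<leftarrow> op (R (i', j'));
                  w \<leftarrow> op (ereal x + v);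
                  le \<leftarrow> op (u \<le> w);
                  if le then op (R((i, j) := w)) else op (R((i, j) := u)) }
                else op (R((i, j) := u)) }))
           R }"

text \<open>
  The minimum is found by a downward scan of \<open>{0..C}\<close>. The start value \<open>C\<close> of \<open>j\<^sup>*\<close> is
  overwritten in the first round whenever \<open>R (K, C) \<ge> b\<close>.
\<close>

definition find_target :: "nat \<Rightarrow> (nat \<times> nat \<Rightarrow> ereal) \<Rightarrow> real \<Rightarrow> nat \<Rightarrow> nat prog" where
  "find_target K R b C =
    do { jstar \<leftarrow> op C;
         for_loop (rev [0..<Suc C])
           (\<lambda>j jstar. do {
              v \<leftarrow> op (R (K, j));
              ok \<leftarrow> op (v \<ge> ereal b);
              if ok then op j else return jstar })
           jstar }"

definition trace_back ::
  "nat \<Rightarrow> (nat \<Rightarrow> nat) \<Rightarrow> (nat \<times> nat \<Rightarrow> ereal) \<Rightarrow> nat \<Rightarrow> (nat \<Rightarrow> nat) prog" where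
  "trace_back K c R jstar =
    do { v \<leftarrow> op (R (K, jstar));
         q \<leftarrow> op v;
         j \<leftarrow> op jstar;
         (z, q, j) \<leftarrow> for_loop (rev [1..<Suc K])
           (\<lambda>i (z, q, j). do {
              i' \<leftarrow> op (i - 1);
              r \<leftarrow> op (R (i', j));
              same \<leftarrow> op (q = r);
              if same then do {
                z \<leftarrow> op (z(i := 0));
                q \<leftarrow> op r;
                return (z, q, j) }
              else do {
                z \<leftarrow> op (z(i := 1));
                ci \<leftarrow> op (c i);
                j' \<leftarrow> op (j - ci);
                r' \<leftarrow> op (R (i', j'));
                q \<leftarrow> op r';
                j \<leftarrow> op j';
                return (z, q, j) } })
           (undefined, q, j);
         return z }"

definition algorithm1 ::
  "nat \<Rightarrow> (nat \<Rightarrow> nat) \<Rightarrow> (nat \<Rightarrow> real) \<Rightarrow> real \<Rightarrow> (nat \<Rightarrow> nat) prog" where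
  "algorithm1 K c p P =
    do { a \<leftarrow> log_weights K p;
         l \<leftarrow> op (ln P);
         b' \<leftarrow> op (- l);
         b \<leftarrow> op b';
         C \<leftarrow> prefix_cost c a b;
         R \<leftarrow> fill_table K c a C;
         jstar \<leftarrow> find_target K R b C;
         trace_back K c R jstar }"


section \<open>Algorithm 2: approximation by rounding the costs\<close>

definition round_costs :: "nat \<Rightarrow> (nat \<Rightarrow> nat) \<Rightarrow> real \<Rightarrow> (nat \<Rightarrow> nat) prog" where
  "round_costs K c \<epsilon> =
    do { cmax \<leftarrow> op (c K);
         t \<leftarrow> op (\<epsilon> * real cmax);
         t' \<leftarrow> op (t / real K);
         \<theta> \<leftarrow> op t';
         for_loop [1..<Suc K]
           (\<lambda>k ct. do {
              x \<leftarrow> op (c k);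
              y \<leftarrow> op (real x / \<theta>);
              m \<leftarrow> op (nat \<lceil>y\<rceil>);
              op (ct(k := m)) })
           undefined }"

definition algorithm2 ::
  "nat \<Rightarrow> (nat \<Rightarrow> nat) \<Rightarrow> (nat \<Rightarrow> real) \<Rightarrow> real \<Rightarrow> real \<Rightarrow> (nat \<Rightarrow> nat) prog" where
  "algorithm2 K c p P \<epsilon> = do { ct \<leftarrow> round_costs K c \<epsilon>; algorithm1 K ct p P }"

definition rounded_cost :: "nat \<Rightarrow> (nat \<Rightarrow> nat) \<Rightarrow> real \<Rightarrow> nat \<Rightarrow> nat" where
  "rounded_cost K c \<epsilon> k =
    nat \<lceil>real (c k) / (\<epsilon> * real (Max (c ` {1..K})) / real K)\<rceil>"

text \<open>The table \<open>ct\<close> of \<open>algorithm2\<close> holds exactly the integers \<open>rounded_cost\<close>.\<close>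

lemma for_loop_map_table:
  assumes "\<And>k T. k \<in> set ks \<Longrightarrow> \<exists>n. body k T = Some (T(k := g k), n)"
  shows "\<exists>n. for_loop ks body T0 = Some (\<lambda>k. if k \<in> set ks then g k else T0 k, n)"
  using assms
proof (induction ks arbitrary: T0)
  case Nil
  then show ?case by (simp add: seq_def op_def return_def)
next
  case (Cons k ks)
  obtain n where n: "body k T0 = Some (T0(k := g k), n)"
    using Cons.prems by fastforce
  obtain m where m: "for_loop ks body (T0(k := g k)) =
      Some (\<lambda>i. if i \<in> set ks then g i else (T0(k := g k)) i, m)"
    using Cons.IH Cons.prems by (meson list.set_intros(2))
  have "(\<lambda>i. if i \<in> set ks then g i else (T0(k := g k)) i) =
      (\<lambda>i. if i \<in> set (k # ks) then g i else T0 i)"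
    by auto
  with n m show ?case by (simp add: seq_def op_def)
qed

lemma round_costs_correct:
  assumes "K \<ge> 1" and "mono_on {1..K} c"
  shows "\<exists>ct n. round_costs K c \<epsilon> = Some (ct, n) \<and>
    (\<forall>k\<in>{1..K}. ct k = rounded_cost K c \<epsilon> k)"
proof -
  have "Max (c ` {1..K}) = c K"
    using assms by (intro Max_eqI) (auto intro: mono_onD)
  then have "\<exists>n. for_loop [1..<Suc K]
           (\<lambda>k ct. do {
              x \<leftarrow> op (c k);
              y \<leftarrow> op (real x / (\<epsilon> * real (c K) / real K));
              m \<leftarrow> op (nat \<lceil>y\<rceil>);
              op (ct(k := m)) })
           undefined =
         Some (\<lambda>k. if k \<in> set [1..<Suc K] then rounded_cost K c \<epsilon> k else undefined k, n)"
    by (intro for_loop_map_table) (simp add: seq_def op_def rounded_cost_def)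
  then show ?thesis
    by (auto simp: round_costs_def seq_def op_def simp del: upt_Suc)
qed

definition max_rounded_cost :: "nat \<Rightarrow> (nat \<Rightarrow> nat) \<Rightarrow> real \<Rightarrow> nat" where
  "max_rounded_cost K c \<epsilon> = Max (rounded_cost K c \<epsilon> ` {1..K})"


section \<open>Admissible inputs\<close>

definition algorithm1_inputs :: "(nat \<times> (nat \<Rightarrow> nat) \<times> (nat \<Rightarrow> real) \<times> real) set" where
  "algorithm1_inputs = {(K, c, p, P).
     K \<ge> 1 \<and> (\<forall>k\<in>{1..K}. c k \<ge> 1) \<and> mono_on {1..K} c \<and>
     (\<forall>k\<in>{1..K}. 0 < p k \<and> p k \<le> 1) \<and> 0 < P \<and> P \<le> 1 \<and> (\<Prod>k=1..K. p k) \<le> P}"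

definition algorithm2_inputs ::
  "(nat \<times> (nat \<Rightarrow> nat) \<times> (nat \<Rightarrow> real) \<times> real \<times> real) set" where
  "algorithm2_inputs = {(K, c, p, P, \<epsilon>). (K, c, p, P) \<in> algorithm1_inputs \<and> \<epsilon> > 0}"

text \<open>
  Since \<open>\<lceil>K/\<epsilon>\<rceil> \<ge> 1\<close> while \<open>K/\<epsilon> \<rightarrow> 0\<close> as \<open>\<epsilon> \<rightarrow> \<infinity>\<close>, replacing \<open>\<lceil>K/\<epsilon>\<rceil>\<close> by \<open>K/\<epsilon>\<close> within a
  big-O needs \<open>K/\<epsilon>\<close> bounded away from \<open>0\<close>. For every \<open>\<epsilon>0 > 0\<close>, the inputs with \<open>\<epsilon> \<le> \<epsilon>0\<close> lie
  in the following set with \<open>M = \<epsilon>0\<close>.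
\<close>

definition algorithm2_inputs_upto ::
  "real \<Rightarrow> (nat \<times> (nat \<Rightarrow> nat) \<times> (nat \<Rightarrow> real) \<times> real \<times> real) set" where
  "algorithm2_inputs_upto M = {(K, c, p, P, \<epsilon>). (K, c, p, P, \<epsilon>) \<in> algorithm2_inputs \<and> \<epsilon> \<le> M * real K}"

end

(*
  Every loop has a body of bounded cost and, apart from the while loop, a fixed number of rounds.
  The while loop stops after at most K rounds, because the input condition prod p <= P says that
  the sum of all weights a_k = - ln p_k reaches b = - ln P; hence C is at most the sum of all
  rounded costs, i.e. at most K times the largest one. The table of size (K+1)(C+1) dominates.
*)
theory Submission
  imports Defs
begin

section \<open>A Hoare-style calculus for results and costs\<close>

text \<open>This is a total-correctness triple with a budget: it includes termination, since a
  diverging run is \<open>None\<close>. The cost is only bounded above, so branches of different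
  cost can share one budget.\<close>

definition runs_within :: "'a prog \<Rightarrow> nat \<Rightarrow> ('a \<Rightarrow> bool) \<Rightarrow> bool" where
  "runs_within m n Q \<longleftrightarrow> (\<exists>x s. m = Some (x, s) \<and> s \<le> n \<and> Q x)"

lemma runs_within_return: "Q x \<Longrightarrow> runs_within (return x) n Q"
  by (simp add: runs_within_def return_def)

lemma runs_within_op: "Q x \<Longrightarrow> 1 \<le> n \<Longrightarrow> runs_within (op x) n Q"
  by (simp add: runs_within_def op_def)

lemma runs_within_seq:
  assumes "runs_within m n1 P" and "\<And>x. P x \<Longrightarrow> runs_within (f x) n2 Q" and "n1 + n2 \<le> n"
  shows "runs_within (seq m f) n Q"
  using assms(1,3) assms(2) unfolding runs_within_def seq_def by fastforce

text \<open>Counting the budget down from an arbitrary \<open>n\<close> lets introduction run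
  through a straight-line block without choosing how to split the budget; only arithmetic side
  conditions remain.\<close>

lemma runs_within_op_seq:
  assumes "runs_within (f x) (n - 1) Q" and "0 < n"
  shows "runs_within (seq (op x) f) n Q"
  by (rule runs_within_seq[where P = "\<lambda>y. y = x" and ?n1.0 = 1 and ?n2.0 = "n - 1"])
    (use assms in \<open>auto intro: runs_within_op\<close>)

lemma runs_within_mono:
  assumes "runs_within m n P" and "\<And>x. P x \<Longrightarrow> Q x" and "n \<le> n'"
  shows "runs_within m n' Q"
  using assms unfolding runs_within_def by fastforce

text \<open>Each round pays \<open>n\<close> for the body and 3 for the loop control; the final 1 is
  the comparison that ends the loop. Only cost is tracked here; where table entries matter, they
  come from \<open>for_loop_map_table\<close>.\<close>

lemma runs_within_for_loop:
  assumes "\<And>i s. i \<in> set is \<Longrightarrow> runs_within (body i s) n (\<lambda>_. True)"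
  shows "runs_within (for_loop is body s) (length is * (n + 3) + 1) (\<lambda>_. True)"
  using assms
proof (induction "is" arbitrary: s)
  case Nil
  show ?case
    by (auto intro!: runs_within_op_seq runs_within_return)
next
  case (Cons i "is")
  have "runs_within (seq (body i s) (for_loop is body)) (n + (length is * (n + 3) + 1)) (\<lambda>_. True)"
    by (rule runs_within_seq[OF Cons.prems Cons.IH]) (auto intro: Cons.prems)
  then show ?case
    by (auto intro!: runs_within_op_seq elim: runs_within_mono)
qed

text \<open>Induction on the variant \<open>V\<close>, which bounds the number of remaining rounds.
  Each round costs one test and one body, and the extra \<open>m\<close> pays for the failing test.
  The body's triple sits inside the test's postcondition, so it may use that the test
  succeeded.\<close>

lemma runs_within_while_loop:
  assumes "I s"
    and step: "\<And>s. I s \<Longrightarrow> runs_within (test s) m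
      (\<lambda>b. b \<longrightarrow> runs_within (body s) n (\<lambda>s'. I s' \<and> V s' < V s))"
  shows "runs_within (while_loop test body s) (V s * (m + n) + m) I"
  using \<open>I s\<close>
proof (induction "V s" arbitrary: s rule: less_induct)
  case less
  have rest: "runs_within (if b then seq (body s) (while_loop test body) else return s) (V s * (m + n)) I"
    if b: "b \<longrightarrow> runs_within (body s) n (\<lambda>s'. I s' \<and> V s' < V s)" for b
  proof (cases b)
    case True
    then have body: "runs_within (body s) n (\<lambda>s'. I s' \<and> V s' < V s)"
      using b by blast
    \<comment> \<open>The run of the body ends in a state with a strictly smaller variant, which is
      impossible from variant 0.\<close>
    then have "V s > 0"
      unfolding runs_within_def by auto
    have "runs_within (seq (body s) (while_loop test body)) (V s * (m + n)) I"
    proof (rule runs_within_seq[OF body])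
      fix s' assume s': "I s' \<and> V s' < V s"
      then have "V s' * (m + n) \<le> (V s - 1) * (m + n)"
        by (intro mult_right_mono) auto
      then show "runs_within (while_loop test body s') ((V s - 1) * (m + n) + m) I"
        using less.hyps[of s'] s' by (auto elim: runs_within_mono)
    next
      show "n + ((V s - 1) * (m + n) + m) \<le> V s * (m + n)"
        using \<open>V s > 0\<close> by (cases "V s") auto
    qed
    then show ?thesis using True by simp
  qed (use less.prems in \<open>auto intro: runs_within_return\<close>)
  show ?case
    by (subst while_loop.simps, rule runs_within_seq[OF step[OF less.prems] rest]) auto
qed

section \<open>Costs of the phases of Algorithm 1\<close>

text \<open>Cost and table entries are derived separately; as a program has at most one result, the
  two facts concern the same run.\<close>

lemma runs_within_log_weights:
  "runs_within (log_weights K p) (7 * K + 1) (\<lambda>a. \<forall>k\<in>{1..K}. a k = - ln (p k))"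
proof -
  have "runs_within (log_weights K p) (7 * K + 1) (\<lambda>_. True)"
    unfolding log_weights_def
    by (rule runs_within_mono[OF runs_within_for_loop[where n = 4]])
      (auto intro!: runs_within_op_seq runs_within_op)
  moreover have "\<exists>n. log_weights K p =
      Some (\<lambda>k. if k \<in> set [1..<Suc K] then - ln (p k) else undefined k, n)"
    unfolding log_weights_def by (intro for_loop_map_table) (simp add: seq_def op_def)
  ultimately show ?thesis
    unfolding runs_within_def by (auto simp del: upt_Suc)
qed

text \<open>The assumption makes the loop stop by the time all \<open>K\<close> weights are added,
  so \<open>C\<close> is a partial sum of the costs. This yields both the round count and the bound
  on the table width.\<close>

lemma runs_within_prefix_cost:
  assumes "b \<le> (\<Sum>k=1..K. a k)"
  shows "runs_within (prefix_cost c a b) (9 * K + 4) (\<lambda>C. C \<le> (\<Sum>k=1..K. c k))"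
proof -
  \<comment> \<open>\<open>k\<close> is the next index to be added, hence it may reach
    \<open>Suc K\<close> and the sums exclude \<open>k\<close>.\<close>
  define I where "I = (\<lambda>(A, C, k). 1 \<le> k \<and> k \<le> Suc K \<and>
    A = (\<Sum>i=1..<k. a i) \<and> C = (\<Sum>i=1..<k. c i))"
  define V where "V = (\<lambda>(A :: real, C :: nat, k). Suc K - k)"
  have le_K: "k \<le> K" if "I (A, C, k)" "A < b" for A C k
  proof (rule ccontr)
    \<comment> \<open>At \<open>k = Suc K\<close> the accumulated \<open>A\<close> is the full sum
      of the weights, which is at least \<open>b\<close>, so the test would have failed.\<close>
    assume "\<not> k \<le> K"
    with that have "k = Suc K" by (auto simp: I_def)
    with that assms show False by (simp add: I_def atLeastLessThanSuc_atLeastAtMost)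
  qed
  let ?test = "\<lambda>(A, C :: nat, k :: nat). op (A < b)"
  let ?body = "\<lambda>(A, C, k). do {
      x \<leftarrow> op (a k); A' \<leftarrow> op (A + x); A \<leftarrow> op A';
      y \<leftarrow> op (c k); C' \<leftarrow> op (C + y); C \<leftarrow> op C';
      k' \<leftarrow> op (k + 1); k \<leftarrow> op k';
      return (A, C, k) }"
  \<comment> \<open>A test is 1 operation and a body 8; the initial variant is
    \<open>K\<close>.\<close>
  have "runs_within (while_loop ?test ?body (0, 0, 1)) (V (0, 0, 1) * (1 + 8) + 1) I"
  proof (rule runs_within_while_loop)
    show "I (0, 0, 1)" by (simp add: I_def)
  next
    fix s assume I: "I s"
    obtain A C k where s: "s = (A, C, k)" by (cases s)
    have "runs_within (?body s) 8 (\<lambda>s'. I s' \<and> V s' < V s)" if "A < b"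
      using le_K[of A C k] I that unfolding s
      by (auto simp: I_def V_def intro!: runs_within_op_seq runs_within_return)
    then show "runs_within (?test s) 1 (\<lambda>b. b \<longrightarrow> runs_within (?body s) 8 (\<lambda>s'. I s' \<and> V s' < V s))"
      by (simp add: s runs_within_op)
  qed
  then have loop: "runs_within (while_loop ?test ?body (0, 0, 1)) (9 * K + 1) I"
    by (simp add: V_def mult.commute)
  have C_le: "C \<le> (\<Sum>k=1..K. c k)" if "I (A, C, k)" for A C k
    using that by (auto simp: I_def intro!: sum_mono2)
  show ?thesis
    unfolding prefix_cost_def
    by (intro runs_within_op_seq, rule runs_within_seq[OF loop, where ?n2.0 = 0])
      (auto intro!: runs_within_return dest: C_le)
qed

text \<open>The longest path through a cell has 10 operations, and loop control makes it 13. There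
  are \<open>C + 1\<close> cells in each of the \<open>K\<close> computed rows; the remaining terms
  pay for row 0 and the outer loop control.\<close>

lemma runs_within_fill_table:
  "runs_within (fill_table K c a C) (13 * K * (C + 1) + 4 * K + 4 * C + 3) (\<lambda>_. True)"
proof -
  let ?row = "13 * (C + 1) + 1"
  have row: "runs_within (for_loop [0..<Suc C] (body i) R) ?row (\<lambda>_. True)"
    if "\<And>j R. runs_within (body i j R) 10 (\<lambda>_. True)" for body R i
    by (rule runs_within_mono[OF runs_within_for_loop[where n = 10]]) (use that in auto)
  show ?thesis
    unfolding fill_table_def
    by (intro runs_within_op_seq,
        rule runs_within_seq[OF runs_within_for_loop[where n = 1] runs_within_for_loop[where n = ?row]],
        rule runs_within_op, simp, simp, rule row)
      (auto simp: algebra_simps intro!: runs_within_op_seq runs_within_op)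
qed

lemma runs_within_find_target:
  "runs_within (find_target K R b C) (6 * C + 8) (\<lambda>_. True)"
  unfolding find_target_def
  by (intro runs_within_op_seq, rule runs_within_mono[OF runs_within_for_loop[where n = 3]])
    (auto intro!: runs_within_op_seq runs_within_op runs_within_return)

lemma runs_within_trace_back:
  "runs_within (trace_back K c R jstar) (12 * K + 4) (\<lambda>_. True)"
  unfolding trace_back_def
  by (intro runs_within_op_seq,
      rule runs_within_seq[OF runs_within_for_loop[where n = 9], where ?n2.0 = 0])
    (auto intro!: runs_within_op_seq runs_within_return)

text \<open>The conditions on \<open>K\<close>, \<open>p\<close>, \<open>P\<close> are taken from an
  input with its own costs \<open>c'\<close>. Thus admissibility of the original input can be used
  directly when \<open>c\<close> is the rounded table, of which just the bound \<open>m\<close> has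
  to be known.\<close>

lemma runs_within_algorithm1:
  assumes "(K, c', p, P) \<in> algorithm1_inputs"
    and "\<And>k. k \<in> {1..K} \<Longrightarrow> c k \<le> m" and "m \<ge> 1"
  shows "runs_within (algorithm1 K c p P) (100 * (K\<^sup>2 * m)) (\<lambda>_. True)"
proof -
  have K: "K \<ge> 1" and p: "\<And>k. k \<in> {1..K} \<Longrightarrow> 0 < p k" and P: "0 < P" "(\<Prod>k=1..K. p k) \<le> P"
    using assms(1) by (auto simp: algorithm1_inputs_def)
  have "0 < (\<Prod>k=1..K. p k)"
    using p by (intro prod_pos) auto
  \<comment> \<open>Taking logarithms turns the product condition into the lower bound on the total
    weight that \<open>runs_within_prefix_cost\<close> assumes.\<close>
  then have "- ln P \<le> - ln (\<Prod>k=1..K. p k)"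
    using P by simp
  also have "ln (\<Prod>k=1..K. p k) = (\<Sum>k=1..K. ln (p k))"
    using p by (intro ln_prod) force+
  finally have b: "- ln P \<le> (\<Sum>k=1..K. - ln (p k))"
    by (simp add: sum_negf)
  have "(\<Sum>k=1..K. c k) \<le> K * m"
    using sum_bounded_above[of "{1..K}" c m] assms(2) by simp
  \<comment> \<open>Converts the postcondition of \<open>prefix_cost\<close> into
    \<open>C \<le> K * m\<close>, the form used for the table and the scan.\<close>
  note C_le = le_trans[OF _ this]
  let ?fill = "13 * (K\<^sup>2 * m) + 17 * K + 4 * (K * m) + 3"
  let ?find = "6 * (K * m) + 8"
  let ?trace = "12 * K + 4"
  have fill: "runs_within (fill_table K c a C) ?fill (\<lambda>_. True)" if "C \<le> K * m" for a C
  proof (rule runs_within_mono[OF runs_within_fill_table])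
    have "K * C \<le> K\<^sup>2 * m"
      using mult_le_mono2[OF that, of K] by (simp add: power2_eq_square mult.assoc)
    then show "13 * K * (C + 1) + 4 * K + 4 * C + 3 \<le> ?fill"
      using that by (simp add: algebra_simps)
  qed simp
  have find: "runs_within (find_target K R b C) ?find (\<lambda>_. True)" if "C \<le> K * m" for R b C
    using that by (intro runs_within_mono[OF runs_within_find_target]) auto
  have "runs_within (algorithm1 K c p P)
      (7 * K + 1 + (3 + (9 * K + 4 + (?fill + (?find + ?trace))))) (\<lambda>_. True)"
    unfolding algorithm1_def
  proof (rule runs_within_seq[OF runs_within_log_weights], intro runs_within_op_seq)
    fix a :: "nat \<Rightarrow> real" assume a: "\<forall>k\<in>{1..K}. a k = - ln (p k)"
    have "- ln P \<le> (\<Sum>k=1..K. a k)"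
      using b a by simp
    note prefix = runs_within_prefix_cost[OF this]
    \<comment> \<open>The three subtractions come from the operations that compute and store
      \<open>b\<close>.\<close>
    show "runs_within (seq (prefix_cost c a (- ln P)) (\<lambda>C. seq (fill_table K c a C)
        (\<lambda>R. seq (find_target K R (- ln P) C) (trace_back K c R))))
        (3 + (9 * K + 4 + (?fill + (?find + ?trace))) - 1 - 1 - 1) (\<lambda>_. True)"
      by (rule runs_within_seq[OF prefix], drule C_le,
          rule runs_within_seq[OF fill], assumption,
          rule runs_within_seq[OF find runs_within_trace_back]) auto
  qed simp_all
  \<comment> \<open>These absorb all lower-order terms; the coefficients then add up to 91, which
    100 covers.\<close>
  moreover have "K \<le> K\<^sup>2 * m" "K * m \<le> K\<^sup>2 * m" "1 \<le> K\<^sup>2 * m"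
    using K assms(3) by (auto simp: power2_eq_square Suc_le_eq)
  then have "7 * K + 1 + (3 + (9 * K + 4 + (?fill + (?find + ?trace)))) \<le> 100 * (K\<^sup>2 * m)"
    by linarith
  ultimately show ?thesis
    by (blast intro: runs_within_mono)
qed

section \<open>Rounded costs and the cost of Algorithm 2\<close>

text \<open>Rounding is monotone, so the maximum is attained at \<open>K\<close>. There
  \<open>c K\<close> is also the maximal cost and cancels in the quotient, leaving
  \<open>K / \<epsilon>\<close>.\<close>

lemma max_rounded_cost_eq:
  assumes "(K, c, p, P, \<epsilon>) \<in> algorithm2_inputs"
  shows "int (max_rounded_cost K c \<epsilon>) = \<lceil>real K / \<epsilon>\<rceil>"
proof -
  have K: "K \<ge> 1" and c: "\<And>k. k \<in> {1..K} \<Longrightarrow> c k \<ge> 1" "mono_on {1..K} c" and \<epsilon>: "\<epsilon> > 0"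
    using assms by (auto simp: algorithm1_inputs_def algorithm2_inputs_def)
  have Max: "Max (c ` {1..K}) = c K"
    using K c by (intro Max_eqI) (auto intro: mono_onD)
  have "max_rounded_cost K c \<epsilon> = rounded_cost K c \<epsilon> K"
    unfolding max_rounded_cost_def
  proof (rule Max_eqI)
    fix y assume "y \<in> rounded_cost K c \<epsilon> ` {1..K}"
    then obtain k where k: "k \<in> {1..K}" "y = rounded_cost K c \<epsilon> k" by auto
    then have "c k \<le> c K"
      using c by (auto intro: mono_onD)
    then show "y \<le> rounded_cost K c \<epsilon> K"
      unfolding k rounded_cost_def using \<epsilon>
      by (intro nat_mono ceiling_mono divide_right_mono) auto
  qed (use K in auto)
  also have "\<dots> = nat \<lceil>real K / \<epsilon>\<rceil>"
    using c(1)[of K] K by (simp add: rounded_cost_def Max[unfolded One_nat_def])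
  moreover have "0 \<le> real K / \<epsilon>"
    using \<epsilon> by simp
  then have "0 \<le> \<lceil>real K / \<epsilon>\<rceil>"
    by linarith
  ultimately show ?thesis
    by (simp only: nat_0_le)
qed

lemma runs_within_algorithm2:
  assumes "(K, c, p, P, \<epsilon>) \<in> algorithm2_inputs"
  shows "runs_within (algorithm2 K c p P \<epsilon>) (200 * (K\<^sup>2 * max_rounded_cost K c \<epsilon>)) (\<lambda>_. True)"
proof -
  let ?m = "max_rounded_cost K c \<epsilon>"
  have in1: "(K, c, p, P) \<in> algorithm1_inputs" and K: "K \<ge> 1" and \<epsilon>: "\<epsilon> > 0"
    and mono: "mono_on {1..K} c"
    using assms by (auto simp: algorithm1_inputs_def algorithm2_inputs_def)
  have "\<lceil>real K / \<epsilon>\<rceil> \<ge> 1"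
    using K \<epsilon> by simp
  then have m: "?m \<ge> 1"
    using max_rounded_cost_eq[OF assms] by linarith
  have "runs_within (round_costs K c \<epsilon>) (7 * K + 5) (\<lambda>_. True)"
    unfolding round_costs_def
    by (intro runs_within_op_seq, rule runs_within_mono[OF runs_within_for_loop[where n = 4]])
      (auto intro!: runs_within_op_seq runs_within_op)
  \<comment> \<open>By \<open>round_costs_correct\<close> the entries are the
    \<open>rounded_cost\<close> values, each bounded by their maximum \<open>?m\<close>.\<close>
  then have round: "runs_within (round_costs K c \<epsilon>) (7 * K + 5) (\<lambda>ct. \<forall>k\<in>{1..K}. ct k \<le> ?m)"
    using round_costs_correct[OF K mono, of \<epsilon>]
    unfolding runs_within_def max_rounded_cost_def by auto
  show ?thesis
    unfolding algorithm2_def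
  proof (rule runs_within_seq[OF round runs_within_algorithm1[OF in1]])
    \<comment> \<open>Rounding thus costs at most 12 further multiples of
      \<open>K\<^sup>2 * ?m\<close>.\<close>
    have "K \<le> K\<^sup>2 * ?m" "1 \<le> K\<^sup>2 * ?m"
      using K m by (auto simp: power2_eq_square Suc_le_eq)
    then show "7 * K + 5 + 100 * (K\<^sup>2 * ?m) \<le> 200 * (K\<^sup>2 * ?m)"
      by linarith
  qed (use m in auto)
qed

lemma steps_algorithm2_le:
  assumes "(K, c, p, P, \<epsilon>) \<in> algorithm2_inputs"
  shows "real (steps (algorithm2 K c p P \<epsilon>)) \<le> 200 * (real K ^ 2 * real (max_rounded_cost K c \<epsilon>))"
proof -
  have "steps (algorithm2 K c p P \<epsilon>) \<le> 200 * (K\<^sup>2 * max_rounded_cost K c \<epsilon>)"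
    using runs_within_algorithm2[OF assms] by (auto simp: runs_within_def steps_def)
  then have "real (steps (algorithm2 K c p P \<epsilon>)) \<le> real (200 * (K\<^sup>2 * max_rounded_cost K c \<epsilon>))"
    by (simp only: of_nat_le_iff)
  then show ?thesis by simp
qed

text \<open>A ceiling exceeds its argument by less than 1. The polynomial and the cubic bound both
  rest on this estimate.\<close>

lemma max_rounded_cost_le:
  assumes "(K, c, p, P, \<epsilon>) \<in> algorithm2_inputs"
  shows "real (max_rounded_cost K c \<epsilon>) \<le> real K / \<epsilon> + 1"
  using max_rounded_cost_eq[OF assms] by linarith

section \<open>Asymptotic bounds\<close>

text \<open>With a principal filter, a big-O statement is a bound with one constant valid at every
  input of the set, rather than only eventually.\<close>

theorem mainTheorem5:
  shows
    "(\<forall>(K, c, p, P, \<epsilon>) \<in> algorithm2_inputs.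
        algorithm2 K c p P \<epsilon> \<noteq> None \<and>
        int (max_rounded_cost K c \<epsilon>) = \<lceil>real K / \<epsilon>\<rceil>)
     \<and> (\<lambda>(K, c, p, P, \<epsilon>). real (steps (algorithm2 K c p P \<epsilon>)))
         \<in> O[principal algorithm2_inputs](\<lambda>(K, c, p, P, \<epsilon>). real K ^ 2 * real (max_rounded_cost K c \<epsilon>))
     \<and> O[principal algorithm2_inputs](\<lambda>(K, c, p, P, \<epsilon>). real K ^ 2 * real (max_rounded_cost K c \<epsilon>))
         = O[principal algorithm2_inputs](\<lambda>(K, c, p, P, \<epsilon>). real K ^ 2 * real_of_int \<lceil>real K / \<epsilon>\<rceil>)
     \<and> (\<forall>M > 0.
         O[principal (algorithm2_inputs_upto M)](\<lambda>(K, c, p, P, \<epsilon>). real K ^ 2 * real_of_int \<lceil>real K / \<epsilon>\<rceil>)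
           = O[principal (algorithm2_inputs_upto M)](\<lambda>(K, c, p, P, \<epsilon>). real K ^ 3 / \<epsilon>)
         \<and> (\<lambda>(K, c, p, P, \<epsilon>). real (steps (algorithm2 K c p P \<epsilon>)))
           \<in> O[principal (algorithm2_inputs_upto M)](\<lambda>(K, c, p, P, \<epsilon>). real K ^ 3 / \<epsilon>))
     \<and> (\<exists>(d::nat) (q :: nat \<Rightarrow> nat \<Rightarrow> real). \<forall>(K, c, p, P, \<epsilon>) \<in> algorithm2_inputs.
         real (steps (algorithm2 K c p P \<epsilon>))
           \<le> (\<Sum>i\<le>d. \<Sum>j\<le>d. q i j * real K ^ i * (1 / \<epsilon>) ^ j))
     \<and> (\<forall>\<epsilon> > 0. (\<lambda>(K, c, p, P). real (steps (algorithm2 K c p P \<epsilon>)))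
         \<in> O[principal algorithm1_inputs](\<lambda>(K, c, p, P). real K ^ 3))"
proof -
  let ?S = "\<lambda>(K, c, p, P, \<epsilon>). real (steps (algorithm2 K c p P \<epsilon>))"
  let ?f = "\<lambda>(K, c, p, P, \<epsilon>). real K ^ 2 * real (max_rounded_cost K c \<epsilon>)"
  let ?g = "\<lambda>(K :: nat, c :: nat \<Rightarrow> nat, p :: nat \<Rightarrow> real, P :: real, \<epsilon>).
    real K ^ 2 * real_of_int \<lceil>real K / \<epsilon>\<rceil>"
  let ?h = "\<lambda>(K :: nat, c :: nat \<Rightarrow> nat, p :: nat \<Rightarrow> real, P :: real, \<epsilon>). real K ^ 3 / \<epsilon>"
  have fg: "?f x = ?g x" if "x \<in> algorithm2_inputs" for x
  proof (cases x)
    case (fields K c p P \<epsilon>)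
    then have "int (max_rounded_cost K c \<epsilon>) = \<lceil>real K / \<epsilon>\<rceil>"
      using that max_rounded_cost_eq by blast
    then have "real (max_rounded_cost K c \<epsilon>) = real_of_int \<lceil>real K / \<epsilon>\<rceil>"
      by linarith
    then show ?thesis
      by (simp only: fields prod.case)
  qed
  have Sf: "?S x \<le> 200 * ?f x" if "x \<in> algorithm2_inputs" for x
    using that steps_algorithm2_le by (cases x) (simp only: prod.case)
  have bigo_f: "?S \<in> O[principal algorithm2_inputs](?f)"
  proof (rule bigoI[of _ 200])
    show "\<forall>\<^sub>F x in principal algorithm2_inputs. norm (?S x) \<le> 200 * norm (?f x)"
      unfolding eventually_principal
    proof
      fix x assume "x \<in> algorithm2_inputs"
      moreover have "0 \<le> ?S x" "0 \<le> ?f x"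
        by (auto split: prod.split)
      ultimately show "norm (?S x) \<le> 200 * norm (?f x)"
        using Sf by (simp only: real_norm_def abs_of_nonneg)
    qed
  qed
  have bigo_fg: "O[principal algorithm2_inputs](?f) = O[principal algorithm2_inputs](?g)"
    by (rule landau_o.big.cong, unfold eventually_principal) (rule ballI, rule fg)
  have halting: "\<forall>(K, c, p, P, \<epsilon>) \<in> algorithm2_inputs.
      algorithm2 K c p P \<epsilon> \<noteq> None \<and> int (max_rounded_cost K c \<epsilon>) = \<lceil>real K / \<epsilon>\<rceil>"
    using runs_within_algorithm2 max_rounded_cost_eq unfolding runs_within_def by blast
  have upto: "O[principal (algorithm2_inputs_upto M)](?g) = O[principal (algorithm2_inputs_upto M)](?h)
      \<and> ?S \<in> O[principal (algorithm2_inputs_upto M)](?h)" if M: "M > 0" for M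
  proof -
    let ?F = "principal (algorithm2_inputs_upto M)"
    have bounds: "0 \<le> ?h x \<and> 0 \<le> ?g x \<and> ?h x \<le> ?g x \<and> ?g x \<le> (1 + M) * ?h x"
      if x: "x \<in> algorithm2_inputs_upto M" for x
    proof -
      obtain K c p P \<epsilon> where [simp]: "x = (K, c, p, P, \<epsilon>)" by (cases x)
      have \<epsilon>: "\<epsilon> > 0" "\<epsilon> \<le> M * real K"
        using x by (auto simp: algorithm2_inputs_upto_def algorithm2_inputs_def)
      have h: "?h x = real K ^ 2 * (real K / \<epsilon>)"
        by (simp add: power3_eq_cube power2_eq_square)
      have "real_of_int \<lceil>real K / \<epsilon>\<rceil> \<le> real K / \<epsilon> + 1"
        by linarith
      \<comment> \<open>The restriction \<open>\<epsilon> \<le> M * real K\<close> absorbs the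
        rounding error 1 into a multiple of \<open>K / \<epsilon>\<close>; hence the constant
        \<open>1 + M\<close>.\<close>
      also have "1 \<le> M * (real K / \<epsilon>)"
        using \<epsilon> by (simp add: field_simps)
      finally have "real_of_int \<lceil>real K / \<epsilon>\<rceil> \<le> (1 + M) * (real K / \<epsilon>)"
        by (simp only: distrib_right mult_1)
      then have "real K ^ 2 * real_of_int \<lceil>real K / \<epsilon>\<rceil> \<le> real K ^ 2 * ((1 + M) * (real K / \<epsilon>))"
        by (intro mult_left_mono) auto
      moreover have "real K ^ 2 * (real K / \<epsilon>) \<le> real K ^ 2 * real_of_int \<lceil>real K / \<epsilon>\<rceil>"
        by (intro mult_left_mono) auto
      moreover have "0 \<le> real K / \<epsilon>"
        using \<epsilon>(1) by simp
      then have "0 \<le> real K ^ 2 * (real K / \<epsilon>)"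
        by (intro mult_nonneg_nonneg) auto
      ultimately show ?thesis
        unfolding h by (simp add: mult.left_commute)
    qed
    have gh: "?g \<in> O[?F](?h)"
    proof (rule bigoI[of _ "1 + M"])
      show "\<forall>\<^sub>F x in ?F. norm (?g x) \<le> (1 + M) * norm (?h x)"
        unfolding eventually_principal
      proof
        fix x assume "x \<in> algorithm2_inputs_upto M"
        from bounds[OF this] show "norm (?g x) \<le> (1 + M) * norm (?h x)"
          by (simp only: real_norm_def abs_of_nonneg)
      qed
    qed
    have hg: "?h \<in> O[?F](?g)"
    proof (rule bigoI[of _ 1])
      show "\<forall>\<^sub>F x in ?F. norm (?h x) \<le> 1 * norm (?g x)"
        unfolding eventually_principal
      proof
        fix x assume "x \<in> algorithm2_inputs_upto M"
        from bounds[OF this] show "norm (?h x) \<le> 1 * norm (?g x)"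
          by (simp only: real_norm_def abs_of_nonneg mult_1)
      qed
    qed
    \<comment> \<open>A bound on all inputs restricts to the smaller set, where \<open>?g\<close>
      may be replaced by \<open>?h\<close>.\<close>
    have "principal (algorithm2_inputs_upto M) \<le> principal algorithm2_inputs"
      by (auto simp: algorithm2_inputs_upto_def)
    then have "?S \<in> O[?F](?g)"
      using bigo_f unfolding bigo_fg by (rule landau_o.big.filter_mono)
    then have "?S \<in> O[?F](?h)"
      using gh by (rule landau_o.big_trans)
    moreover have "O[?F](?g) = O[?F](?h)"
      using gh hg by (auto intro: landau_o.big_trans)
    ultimately show ?thesis by blast
  qed
  have poly: "\<exists>(d::nat) (q :: nat \<Rightarrow> nat \<Rightarrow> real). \<forall>(K, c, p, P, \<epsilon>) \<in> algorithm2_inputs.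
      real (steps (algorithm2 K c p P \<epsilon>)) \<le> (\<Sum>i\<le>d. \<Sum>j\<le>d. q i j * real K ^ i * (1 / \<epsilon>) ^ j)"
  \<comment> \<open>The polynomial is the expansion of
    \<open>200 * K^2 * (K / \<epsilon> + 1)\<close>: its monomials have exponents (3, 1) and (2, 0)
    in \<open>K\<close> and \<open>1 / \<epsilon>\<close>.\<close>
  proof (intro exI[of _ 3]
      exI[of _ "\<lambda>i j. if i = 3 \<and> j = 1 \<or> i = 2 \<and> j = 0 then 200 else 0"] ballI, clarify)
    fix K c p P \<epsilon> assume x: "(K, c, p, P, \<epsilon>) \<in> algorithm2_inputs"
    have "real (steps (algorithm2 K c p P \<epsilon>)) \<le> 200 * (real K ^ 2 * (real K / \<epsilon> + 1))"
      using steps_algorithm2_le[OF x] mult_left_mono[OF max_rounded_cost_le[OF x], of "real K ^ 2"]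
      by simp
    also have "\<dots> = (\<Sum>i\<le>3. \<Sum>j\<le>3. (if i = 3 \<and> j = 1 \<or> i = 2 \<and> j = 0 then 200 else 0)
        * real K ^ i * (1 / \<epsilon>) ^ j)"
      by (simp add: numeral_eq_Suc algebra_simps)
    finally show "real (steps (algorithm2 K c p P \<epsilon>)) \<le> (\<Sum>i\<le>3. \<Sum>j\<le>3.
        (if i = 3 \<and> j = 1 \<or> i = 2 \<and> j = 0 then 200 else 0) * real K ^ i * (1 / \<epsilon>) ^ j)" .
  qed
  have cubic: "(\<lambda>(K, c, p, P). real (steps (algorithm2 K c p P \<epsilon>)))
      \<in> O[principal algorithm1_inputs](\<lambda>(K, c, p, P). real K ^ 3)" if \<epsilon>: "\<epsilon> > 0" for \<epsilon>
  proof (rule bigoI[of _ "200 * (1 / \<epsilon> + 1)"], unfold eventually_principal, clarify)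
    fix K c p P assume x: "(K, c, p, P) \<in> algorithm1_inputs"
    then have x2: "(K, c, p, P, \<epsilon>) \<in> algorithm2_inputs" and K: "real K \<ge> 1"
      using \<epsilon> by (auto simp: algorithm2_inputs_def algorithm1_inputs_def)
    \<comment> \<open>Since \<open>K\<close> is at least 1, the rounding error is at most
      \<open>K\<close>; for fixed \<open>\<epsilon>\<close> the factor
      \<open>1 / \<epsilon> + 1\<close> is part of the constant.\<close>
    have "real (max_rounded_cost K c \<epsilon>) \<le> (1 / \<epsilon> + 1) * real K"
      using max_rounded_cost_le[OF x2] K by (simp add: algebra_simps)
    then have "real K ^ 2 * real (max_rounded_cost K c \<epsilon>) \<le> real K ^ 2 * ((1 / \<epsilon> + 1) * real K)"
      by (intro mult_left_mono) auto
    also have "\<dots> = (1 / \<epsilon> + 1) * real K ^ 3"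
      by (simp only: power3_eq_cube power2_eq_square mult_ac)
    finally have "real (steps (algorithm2 K c p P \<epsilon>)) \<le> 200 * (1 / \<epsilon> + 1) * real K ^ 3"
      using steps_algorithm2_le[OF x2] unfolding mult.assoc by linarith
    then show "norm (real (steps (algorithm2 K c p P \<epsilon>))) \<le> 200 * (1 / \<epsilon> + 1) * norm (real K ^ 3)"
      by simp
  qed
  show ?thesis
    using halting bigo_f bigo_fg upto poly cubic by blast
qed

end
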